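(* Let $d\in\mathbb{N}^*$ be fixed. As $n\to\infty$, the burning number $b(\mathbb{T}_n^d)$ of the discrete torus $\mathbb{T}_n^d$ satisfies \[\left(\alpha_d+o(1)\right)\cdot n^{d/(d+1)}\leq b\left(\mathbb{T}_n^d\right)\leq\left(\gamma_d+o(1)\right)\cdot n^{d/(d+1)},\] where \[\alpha_d=\left(\frac{(d+1)!}{2^d}\right)^{1/(d+1)}\quad\text{and}\quad\gamma_d=\left(\left(1+\frac{1}{d}\right)^d\cdot(d+1)!\right)^{1/(d+1)}.\]
   Context: Notation: $\mathbb{N}^*=\{1,2,\ldots\}$. For $n\in\mathbb{N}^*$, $\mathbb{T}_n^d$ is the discrete Euclidean torus $\mathbb{Z}^d/n\mathbb{Z}^d$ with side length $n$, equipped with its natural (nearest-neighbour) graph structure. The burning number of a finite graph $G$ is \[b(G):=\inf\left\{k\in\mathbb{N}^*:\text{there exist vertices }x_1,\ldots,x_k\in G\text{ such that }\bigcup_{i=1}^k\overline{B}(x_i,k-i)=G\right\},\] where $\overline{B}(x,r)$ denotes the closed ball of radius $r$ around the vertex $x$ for the graph distance in $G$ (and $G$ is identified with its vertex set). *)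

theory Defs
  imports
    Complex_Main
    "HOL-Library.FuncSet"
    "HOL-Library.Landau_Symbols"
    "HOL-Number_Theory.Cong"
    "Graph_Theory.Graph_Theory"
begin

text \<open>
  Undirected graphs are symmetric digraphs (locale \<^locale>\<open>graph\<close>): each edge is a pair of
  opposite arcs.  Giving every arc weight 1, the shortest-path cost \<open>wf_digraph.\<mu>\<close> is the usual
  graph distance, with value \<open>\<infinity>\<close> between different components.
\<close>

definition graph_dist :: "('a, 'b) pre_digraph \<Rightarrow> 'a \<Rightarrow> 'a \<Rightarrow> ereal" where
  "graph_dist G u v = wf_digraph.\<mu> G (\<lambda>_. 1) u v"

definition graph_cball :: "('a, 'b) pre_digraph \<Rightarrow> 'a \<Rightarrow> nat \<Rightarrow> 'a set" where
  "graph_cball G x r = {v \<in> verts G. graph_dist G x v \<le> ereal (real r)}"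

text \<open>
  The infimum is taken in \<^typ>\<open>nat\<close>.  For a finite nonempty graph the set is nonempty
  (burn the vertices one after another), so the infimum is a genuine minimum.
\<close>

definition burning_number :: "('a, 'b) pre_digraph \<Rightarrow> nat" where
  "burning_number G =
     Inf {k. k \<ge> 1 \<and>
       (\<exists>x :: nat \<Rightarrow> 'a. (\<forall>i\<in>{1..k}. x i \<in> verts G) \<and>
          (\<Union>i\<in>{1..k}. graph_cball G (x i) (k - i)) = verts G)}"

text \<open>
  An element of \<open>\<int>\<^sup>d/n\<int>\<^sup>d\<close> is represented by its coordinates in \<open>{0..<n}\<close>, as a function on
  \<open>{..<d}\<close> that is \<^const>\<open>undefined\<close> elsewhere.  The condition \<open>x \<noteq> y\<close> only matters for
  \<open>n = 1\<close>, where it removes the loop; for \<open>n = 2\<close> the two neighbours of a vertex in a given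
  direction coincide.
\<close>

definition torus :: "nat \<Rightarrow> nat \<Rightarrow> (nat \<Rightarrow> int) pair_pre_digraph" where
  "torus d n =
     \<lparr> pverts = {..<d} \<rightarrow>\<^sub>E {0..<int n},
       parcs = {(x, y). x \<in> {..<d} \<rightarrow>\<^sub>E {0..<int n} \<and> y \<in> {..<d} \<rightarrow>\<^sub>E {0..<int n} \<and> x \<noteq> y \<and>
         (\<exists>i<d. ([y i = x i + 1] (mod int n) \<or> [y i = x i - 1] (mod int n)) \<and>
                (\<forall>j<d. j \<noteq> i \<longrightarrow> y j = x j))} \<rparr>"

lemma pair_graph_torus: "pair_graph (torus d n)"
proof -
  let ?V = "{..<d} \<rightarrow>\<^sub>E {0..<int n}"
  have fin: "finite ?V"
    by (intro finite_PiE) auto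
  have "parcs (torus d n) \<subseteq> ?V \<times> ?V"
    by (auto simp: torus_def)
  then have finarcs: "finite (parcs (torus d n))"
    using fin by (meson finite_SigmaI finite_subset)
  have "(y, x) \<in> parcs (torus d n)" if xy: "(x, y) \<in> parcs (torus d n)" for x y
  proof -
    from xy obtain i where i: "i < d"
        "[y i = x i + 1] (mod int n) \<or> [y i = x i - 1] (mod int n)"
        "\<forall>j<d. j \<noteq> i \<longrightarrow> y j = x j"
      and V: "x \<in> ?V" "y \<in> ?V" "x \<noteq> y"
      by (auto simp: torus_def)
    from i(2) have "[x i = y i + 1] (mod int n) \<or> [x i = y i - 1] (mod int n)"
    proof
      assume "[y i = x i + 1] (mod int n)"
      then have "int n dvd y i - (x i + 1)" by (simp only: cong_iff_dvd_diff)
      then have "int n dvd - (y i - (x i + 1))" by (simp only: dvd_minus_iff)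
      then have "int n dvd x i - (y i - 1)" by (simp add: algebra_simps)
      then show ?thesis by (simp only: cong_iff_dvd_diff simp_thms)
    next
      assume "[y i = x i - 1] (mod int n)"
      then have "int n dvd y i - (x i - 1)" by (simp only: cong_iff_dvd_diff)
      then have "int n dvd - (y i - (x i - 1))" by (simp only: dvd_minus_iff)
      then have "int n dvd x i - (y i + 1)" by (simp add: algebra_simps)
      then show ?thesis by (simp only: cong_iff_dvd_diff simp_thms)
    qed
    moreover have "\<forall>j<d. j \<noteq> i \<longrightarrow> x j = y j"
      using i(3) by metis
    ultimately show ?thesis
      unfolding torus_def using i(1) V by auto
  qed
  then have sym: "symmetric (with_proj (torus d n))"
    by (simp add: symmetric_def sym_def)
  have sub: "parcs (torus d n) \<subseteq> {(x, y). x \<in> ?V \<and> y \<in> ?V \<and> x \<noteq> y}"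
    unfolding torus_def pair_pre_digraph.simps by blast
  have e: "fst e \<in> ?V" "snd e \<in> ?V" "fst e \<noteq> snd e" if "e \<in> parcs (torus d n)" for e
    using subsetD[OF sub that] by (simp_all only: mem_Collect_eq case_prod_unfold simp_thms)
  have V: "pverts (torus d n) = ?V"
    by (simp add: torus_def)
  show ?thesis
  proof
    show "finite (pverts (torus d n))"
      unfolding V by (rule fin)
  qed (fact finarcs sym e[folded V])+
qed

definition burning_alpha :: "nat \<Rightarrow> real" where
  "burning_alpha d = (fact (d + 1) / 2 ^ d) powr (1 / real (d + 1))"

definition burning_gamma :: "nat \<Rightarrow> real" where
  "burning_gamma d = ((1 + 1 / real d) ^ d * fact (d + 1)) powr (1 / real (d + 1))"

end

theory Submission
  imports Defs "HOL-Real_Asymp.Real_Asymp"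
begin

text \<open>
  Both bounds come from counting vertices.  As long as \<open>2 * r < n\<close>, a ball of radius \<open>r\<close> in the
  torus is a copy of the \<open>\<ell>\<^sup>1\<close>-ball of radius \<open>r\<close> in \<open>\<int>\<^sup>d\<close>, and for larger \<open>r\<close> it is an image of it.
  The number of lattice points in that \<open>\<ell>\<^sup>1\<close>-ball lies between \<open>2\<^sup>d (r choose d)\<close> and
  \<open>2\<^sup>d ((r + d) choose d)\<close>, hence is asymptotic to \<open>(2 r)\<^sup>d / d!\<close>.

  Lower bound: if balls of radii \<open>0, \<dots>, b - 1\<close> cover the torus, then \<open>n\<^sup>d\<close> is at most the sum of
  their sizes, and the hockey-stick identity bounds this sum by \<open>2\<^sup>d ((b + d) choose (d + 1))\<close>.  This gives
  \<open>\<alpha>\<^sub>d n powr (d / (d + 1)) \<le> b + d\<close> (lemma \<open>burning_alpha_torus\<close>).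

  Upper bound: burn greedily, choosing each new centre outside the balls placed so far, the
  \<open>j\<close>-th of which has radius \<open>k - j\<close>.  If \<open>k\<close> balls do not suffice, then the distance of
  any two centres \<open>x\<^sub>i\<close>, \<open>x\<^sub>j\<close> with \<open>j < i\<close> exceeds \<open>k - j\<close>, so the balls of half the radii are
  disjoint and their sizes add up to at most \<open>n\<^sup>d\<close> (lemma \<open>greedy_burning\<close>).  The sum of the sizes is
  asymptotic to \<open>k\<^sup>d\<^sup>+\<^sup>1 / (d + 1)!\<close>, so \<open>k\<close> is at most \<open>\<beta> n powr (d / (d + 1)) + O(1)\<close>
  with \<open>\<beta> = (d + 1)! powr (1 / (d + 1))\<close>.  Since \<open>(1 + 1 / d)\<^sup>d \<ge> 1\<close>, this constant is at most
  \<open>\<gamma>\<^sub>d\<close>.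
\<close>

section \<open>Balls in a digraph and iterated adjacency\<close>

lemma (in wf_digraph) graph_dist_le_iff_awalk:
  "graph_dist G u v \<le> ereal (real r) \<longleftrightarrow> (\<exists>p. awalk u p v \<and> length p \<le> r)"
proof -
  have cost: "awalk_cost (\<lambda>_. 1) p = real (length p)" for p
    by (induction p) auto
  show ?thesis
  proof
    assume "graph_dist G u v \<le> ereal (real r)"
    also have "ereal (real r) < ereal (real (Suc r))" by simp
    finally obtain p where "awalk u p v" "real (length p) < real (Suc r)"
      by (auto simp: graph_dist_def \<mu>_def INF_less_iff cost)
    then show "\<exists>p. awalk u p v \<and> length p \<le> r"
      by (intro exI[of _ p]) auto
  next
    assume "\<exists>p. awalk u p v \<and> length p \<le> r"
    then obtain p where p: "awalk u p v" "length p \<le> r" by blast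
    have "graph_dist G u v \<le> ereal (awalk_cost (\<lambda>_. 1) p)"
      unfolding graph_dist_def by (rule min_cost_le_walk_cost) (rule p)
    also have "\<dots> \<le> ereal (real r)" using p by (simp add: cost)
    finally show "graph_dist G u v \<le> ereal (real r)" .
  qed
qed

text \<open>
  Adding the diagonal allows walks to pause, so that the relation power \<open>r\<close> captures distance at
  most \<open>r\<close>.  In this form the triangle inequality is \<open>relpow_add\<close>.
\<close>

lemma (in wf_digraph) graph_dist_le_iff_relpow:
  assumes "u \<in> verts G"
  shows "graph_dist G u v \<le> ereal (real r) \<longleftrightarrow> (u, v) \<in> (arcs_ends G \<union> Id) ^^ r"
proof -
  have 1: "(u, v) \<in> (arcs_ends G \<union> Id) ^^ r" if "awalk u p v" "length p \<le> r" for p u r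
    using that
  proof (induction r arbitrary: u p)
    case 0
    then show ?case by (auto simp: awalk_Nil_iff)
  next
    case (Suc r)
    show ?case
    proof (cases p)
      case Nil
      then have "awalk u [] v" using Suc.prems by simp
      moreover from this have "u = v" by (auto simp: awalk_Nil_iff)
      ultimately have "(v, v) \<in> (arcs_ends G \<union> Id) ^^ r" using Suc.IH[of u "[]"] by simp
      then show ?thesis using \<open>u = v\<close> by (auto intro: relpow_Suc_I2)
    next
      case (Cons a q)
      then have a: "a \<in> arcs G" "u = tail G a" "awalk (head G a) q v" "length q \<le> r"
        using Suc.prems by (auto simp: awalk_Cons_iff)
      then have "(u, head G a) \<in> arcs_ends G" by (auto simp: in_arcs_imp_in_arcs_ends)
      then show ?thesis using Suc.IH[OF a(3,4)] by (blast intro: relpow_Suc_I2)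
    qed
  qed
  have 2: "\<exists>p. awalk u p v \<and> length p \<le> r"
    if "u \<in> verts G" "(u, v) \<in> (arcs_ends G \<union> Id) ^^ r" for u r
    using that
  proof (induction r arbitrary: u)
    case 0
    then show ?case by (auto intro!: exI[of _ "[]"] simp: awalk_Nil_iff)
  next
    case (Suc r)
    from Suc.prems(2) obtain w where w: "(u, w) \<in> arcs_ends G \<union> Id"
      "(w, v) \<in> (arcs_ends G \<union> Id) ^^ r" by (rule relpow_Suc_E2)
    have "w \<in> verts G" using w(1) Suc.prems(1) by auto
    then obtain p where p: "awalk w p v" "length p \<le> r" using Suc.IH w(2) by blast
    show ?case
    proof (cases "u = w")
      case True
      then show ?thesis using p by (intro exI[of _ p]) auto
    next
      case False
      then have "(u, w) \<in> arcs_ends G" using w(1) by auto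
      then obtain a where "a \<in> arcs G" "tail G a = u" "head G a = w"
        by (auto simp: arcs_ends_def arc_to_ends_def)
      then show ?thesis using p by (intro exI[of _ "a # p"]) (auto simp: awalk_Cons_iff)
    qed
  qed
  show ?thesis using 1 2 assms by (auto simp: graph_dist_le_iff_awalk)
qed

lemma (in wf_digraph) mem_graph_cball_iff:
  assumes "u \<in> verts G"
  shows "v \<in> graph_cball G u r \<longleftrightarrow> (u, v) \<in> (arcs_ends G \<union> Id) ^^ r"
proof -
  have "v \<in> verts G" if "graph_dist G u v \<le> ereal (real r)"
    using that by (auto simp: graph_dist_le_iff_awalk)
  then show ?thesis using graph_dist_le_iff_relpow[OF assms] by (auto simp: graph_cball_def)
qed

lemma graph_cball_mono: "r \<le> s \<Longrightarrow> graph_cball G x r \<subseteq> graph_cball G x s"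
proof
  fix v assume r: "r \<le> s" and v: "v \<in> graph_cball G x r"
  then have "graph_dist G x v \<le> ereal (real r)" by (simp add: graph_cball_def)
  also have "\<dots> \<le> ereal (real s)" using r by simp
  finally show "v \<in> graph_cball G x s" using v by (simp add: graph_cball_def)
qed

section \<open>The greedy burning strategy\<close>

text \<open>
  The number \<open>g r\<close> is a lower bound on the size of the balls of radius \<open>\<lfloor>r / 2\<rfloor>\<close>.
  If the greedy choice fails, the centres are pairwise far apart: \<open>x\<^sub>i\<close> lies outside the ball of
  radius \<open>k - j\<close> around \<open>x\<^sub>j\<close> for \<open>j < i\<close>, so the balls with half the radii are disjoint.
\<close>

lemma (in graph) greedy_burning:
  fixes g :: "nat \<Rightarrow> nat"
  assumes ne: "verts G \<noteq> {}"
    and ball: "\<And>x r. x \<in> verts G \<Longrightarrow> r < k \<Longrightarrow> g r \<le> card (graph_cball G x (r div 2))"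
    and vol: "card (verts G) < (\<Sum>r<k. g r)"
  shows "\<exists>x. (\<forall>i\<in>{1..k}. x i \<in> verts G) \<and> (\<Union>i\<in>{1..k}. graph_cball G (x i) (k - i)) = verts G"
proof (rule ccontr)
  assume no: "\<not> ?thesis"
  from ne obtain v0 where v0: "v0 \<in> verts G" by blast
  have sub: "graph_cball G x r \<subseteq> verts G" for x r by (auto simp: graph_cball_def)
  \<comment> \<open>Each new centre is chosen outside all earlier balls.\<close>
  have "\<exists>x. (\<forall>i\<in>{1..m}. x i \<in> verts G) \<and>
            (\<forall>i\<in>{1..m}. \<forall>j\<in>{1..<i}. x i \<notin> graph_cball G (x j) (k - j))" if "m \<le> k" for m
    using that
  proof (induction m)
    case 0
    then show ?case by auto
  next
    case (Suc m)
    then obtain x where x: "\<forall>i\<in>{1..m}. x i \<in> verts G"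
      "\<forall>i\<in>{1..m}. \<forall>j\<in>{1..<i}. x i \<notin> graph_cball G (x j) (k - j)" by auto
    define x' where "x' = (\<lambda>i. if i \<le> m then x i else v0)"
    have "\<forall>i\<in>{1..k}. x' i \<in> verts G" using x(1) v0 by (auto simp: x'_def)
    with no have "(\<Union>i\<in>{1..k}. graph_cball G (x' i) (k - i)) \<noteq> verts G" by blast
    moreover have "(\<Union>i\<in>{1..k}. graph_cball G (x' i) (k - i)) \<subseteq> verts G" using sub by blast
    ultimately obtain y where y: "y \<in> verts G"
      "\<forall>i\<in>{1..k}. y \<notin> graph_cball G (x' i) (k - i)" by blast
    have y': "y \<notin> graph_cball G (x i) (k - i)" if "i \<in> {1..m}" for i
      using y(2)[rule_format, of i] that Suc.prems by (simp add: x'_def)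
    show ?case
    proof (intro exI[of _ "x(Suc m := y)"] conjI ballI)
      fix i assume "i \<in> {1..Suc m}"
      then show "(x(Suc m := y)) i \<in> verts G" using x(1) y(1) by auto
    next
      fix i j assume ij: "i \<in> {1..Suc m}" "j \<in> {1..<i}"
      then show "(x(Suc m := y)) i \<notin> graph_cball G ((x(Suc m := y)) j) (k - j)"
        using x(2) y' by (cases "i = Suc m") auto
    qed
  qed
  from this[OF order.refl] obtain x where xV: "\<And>i. i \<in> {1..k} \<Longrightarrow> x i \<in> verts G"
    and far: "\<And>i j. i \<in> {1..k} \<Longrightarrow> j \<in> {1..<i} \<Longrightarrow> x i \<notin> graph_cball G (x j) (k - j)"
    by blast
  define B where "B = (\<lambda>i. graph_cball G (x i) ((k - i) div 2))"
  let ?R = "arcs_ends G \<union> Id"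
  have "sym ?R" using sym_arcs by (auto simp: symmetric_def intro: sym_Un sym_Id)
  then have symR: "sym (?R ^^ n)" for n
  proof (induction n)
    case (Suc n)
    show ?case
    proof (rule symI)
      fix a b assume "(a, b) \<in> ?R ^^ Suc n"
      then obtain c where "(a, c) \<in> ?R ^^ n" "(c, b) \<in> ?R" by (rule relpow_Suc_E)
      then have "(b, c) \<in> ?R" "(c, a) \<in> ?R ^^ n"
        using \<open>sym ?R\<close> Suc.IH[OF Suc.prems] by (blast dest: symD)+
      then show "(b, a) \<in> ?R ^^ Suc n" by (rule relpow_Suc_I2)
    qed
  qed (simp add: sym_Id)
  have disj: "B i \<inter> B j = {}" if ij: "i \<in> {1..k}" "j \<in> {1..<i}" for i j
  proof (rule ccontr)
    assume "B i \<inter> B j \<noteq> {}"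
    then obtain z where z: "z \<in> B i" "z \<in> B j" by blast
    have j: "j \<in> {1..k}" using ij by auto
    have "(x j, z) \<in> ?R ^^ ((k - j) div 2)" "(x i, z) \<in> ?R ^^ ((k - i) div 2)"
      using z mem_graph_cball_iff xV ij(1) j unfolding B_def by blast+
    then have "(x j, x i) \<in> ?R ^^ ((k - j) div 2 + (k - i) div 2)"
      using symR by (auto simp: relpow_add dest: symD)
    then have "x i \<in> graph_cball G (x j) ((k - j) div 2 + (k - i) div 2)"
      using mem_graph_cball_iff[OF xV[OF j]] by blast
    moreover have "(k - j) div 2 + (k - i) div 2 \<le> k - j" using ij by auto
    ultimately have "x i \<in> graph_cball G (x j) (k - j)"
      by (rule subsetD[OF graph_cball_mono, rotated])
    then show False using far[OF ij] by blast
  qed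
  have "disjoint_family_on B {1..k}"
    unfolding disjoint_family_on_def
  proof (intro ballI impI)
    fix i j assume ij: "i \<in> {1..k}" "j \<in> {1..k}" "i \<noteq> j"
    then show "B i \<inter> B j = {}"
      using disj[of i j] disj[of j i] by (cases "j < i") auto
  qed
  moreover have "finite (B i)" for i
    unfolding B_def using sub finite_verts by (rule finite_subset)
  ultimately have "(\<Sum>i\<in>{1..k}. card (B i)) = card (\<Union>i\<in>{1..k}. B i)"
    by (intro card_UN_disjoint'[symmetric]) auto
  also have "\<dots> \<le> card (verts G)"
    using sub by (intro card_mono finite_verts) (auto simp: B_def)
  also have "\<dots> < (\<Sum>r<k. g r)" by (rule vol)
  also have "\<dots> = (\<Sum>i\<in>{1..k}. g (k - i))"
    by (rule sum.reindex_bij_witness[of _ "\<lambda>i. k - i" "\<lambda>r. k - r"]) auto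
  also have "\<dots> \<le> (\<Sum>i\<in>{1..k}. card (B i))"
    using ball xV unfolding B_def by (intro sum_mono) auto
  finally show False by simp
qed

lemma (in graph) burning_number_le:
  fixes g :: "nat \<Rightarrow> nat"
  assumes "verts G \<noteq> {}"
    and "\<And>x r. x \<in> verts G \<Longrightarrow> r < k \<Longrightarrow> g r \<le> card (graph_cball G x (r div 2))"
    and vol: "card (verts G) < (\<Sum>r<k. g r)"
  shows "burning_number G \<le> k"
proof -
  have "k \<ge> 1" using vol by (cases k) auto
  then show ?thesis
    unfolding burning_number_def using greedy_burning[OF assms] by (intro cInf_lower) auto
qed

text \<open>The infimum in the definition of the burning number is attained.\<close>

lemma (in graph) burning_number_attained:
  assumes ne: "verts G \<noteq> {}"
  obtains x where "\<And>i. i \<in> {1..burning_number G} \<Longrightarrow> x i \<in> verts G"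
    "(\<Union>i\<in>{1..burning_number G}. graph_cball G (x i) (burning_number G - i)) = verts G"
proof -
  let ?P = "\<lambda>k. k \<ge> 1 \<and> (\<exists>x. (\<forall>i\<in>{1..k}. x i \<in> verts G) \<and>
    (\<Union>i\<in>{1..k}. graph_cball G (x i) (k - i)) = verts G)"
  have "1 \<le> card (graph_cball G x (r div 2))" if "x \<in> verts G" for x r
  proof -
    have "x \<in> graph_cball G x 0" using mem_graph_cball_iff[OF that] by auto
    then have "x \<in> graph_cball G x (r div 2)"
      by (rule subsetD[OF graph_cball_mono, rotated]) simp
    moreover have "finite (graph_cball G x (r div 2))"
      by (rule finite_subset[OF _ finite_verts]) (auto simp: graph_cball_def)
    ultimately show ?thesis by (metis One_nat_def Suc_leI card_gt_0_iff empty_iff)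
  qed
  \<comment> \<open>Every ball contains its centre, so the trivial bound \<open>g = 1\<close> already makes the greedy
    strategy succeed with one ball more than there are vertices.\<close>
  then have "?P (Suc (card (verts G)))"
    using greedy_burning[OF ne, of "Suc (card (verts G))" "\<lambda>_. 1"] by auto
  then have "burning_number G \<in> Collect ?P"
    unfolding burning_number_def by (intro Inf_nat_def1) blast
  then obtain x where "\<forall>i\<in>{1..burning_number G}. x i \<in> verts G"
    "(\<Union>i\<in>{1..burning_number G}. graph_cball G (x i) (burning_number G - i)) = verts G"
    by blast
  then show ?thesis using that[of x] by blast
qed

section \<open>Counting lattice points in the cross-polytope\<close>

text \<open>
  The integer points of the \<open>\<ell>\<^sup>1\<close>-ball of radius \<open>r\<close> in dimension \<open>d\<close>, centred at the origin.
  As for vertices of the torus, vectors are functions that are \<^const>\<open>undefined\<close> outside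
  \<open>{..<d}\<close>.
\<close>

definition lattice_ball :: "nat \<Rightarrow> nat \<Rightarrow> (nat \<Rightarrow> int) set" where
  "lattice_ball d r = {w \<in> {..<d} \<rightarrow>\<^sub>E UNIV. (\<Sum>i<d. \<bar>w i\<bar>) \<le> int r}"

lemma abs_le_of_lattice_ball: "w \<in> lattice_ball d r \<Longrightarrow> i < d \<Longrightarrow> \<bar>w i\<bar> \<le> int r"
proof -
  assume w: "w \<in> lattice_ball d r" and i: "i < d"
  have "\<bar>w i\<bar> \<le> (\<Sum>i<d. \<bar>w i\<bar>)" using i by (intro member_le_sum) auto
  then show ?thesis using w by (auto simp: lattice_ball_def)
qed

lemma finite_lattice_ball: "finite (lattice_ball d r)"
proof (rule finite_subset)
  show "lattice_ball d r \<subseteq> {..<d} \<rightarrow>\<^sub>E {- int r..int r}"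
  proof
    fix w assume w: "w \<in> lattice_ball d r"
    then have "w i \<in> {- int r..int r}" if "i < d" for i
      using abs_le_of_lattice_ball[OF w that] by auto
    then show "w \<in> {..<d} \<rightarrow>\<^sub>E {- int r..int r}" using w by (auto simp: lattice_ball_def PiE_iff)
  qed
qed (auto intro: finite_PiE)

lemma sum_symmetric_interval:
  fixes h :: "nat \<Rightarrow> nat"
  shows "(\<Sum>t\<in>{- int r..int r}. h (nat \<bar>t\<bar>)) = h 0 + 2 * (\<Sum>i<r. h (Suc i))"
proof (induction r)
  case (Suc r)
  have "{- int (Suc r)..int (Suc r)} =
      insert (- int (Suc r)) (insert (int (Suc r)) {- int r..int r})" by auto
  then show ?case using Suc by (simp add: nat_add_distrib)
qed simp

text \<open>Slicing by the last coordinate.\<close>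

lemma card_lattice_ball_Suc:
  "card (lattice_ball (Suc d) r) =
     card (lattice_ball d r) + 2 * (\<Sum>s<r. card (lattice_ball d s))"
proof -
  let ?S = "SIGMA t:{- int r..int r}. lattice_ball d (r - nat \<bar>t\<bar>)"
  have "bij_betw (\<lambda>w. (w d, restrict w {..<d})) (lattice_ball (Suc d) r) ?S"
  proof (rule bij_betw_byWitness[where f' = "\<lambda>(t, w). w(d := t)"])
    show "\<forall>w\<in>lattice_ball (Suc d) r. (\<lambda>(t, w). w(d := t)) (w d, restrict w {..<d}) = w"
      by (auto simp: lattice_ball_def fun_eq_iff PiE_iff extensional_def)
    show "\<forall>p\<in>?S. (\<lambda>w. (w d, restrict w {..<d})) ((\<lambda>(t, w). w(d := t)) p) = p"
      by (auto simp: lattice_ball_def fun_eq_iff PiE_iff extensional_def)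
    show "(\<lambda>w. (w d, restrict w {..<d})) ` lattice_ball (Suc d) r \<subseteq> ?S"
    proof (rule image_subsetI)
      fix w assume w: "w \<in> lattice_ball (Suc d) r"
      from abs_le_of_lattice_ball[OF this, of d] have t: "w d \<in> {- int r..int r}" by auto
      then have "int (r - nat \<bar>w d\<bar>) = int r - \<bar>w d\<bar>" by (subst of_nat_diff) auto
      then have "restrict w {..<d} \<in> lattice_ball d (r - nat \<bar>w d\<bar>)"
        using w by (simp add: lattice_ball_def)
      then show "(w d, restrict w {..<d}) \<in> ?S" by (rule SigmaI[OF t])
    qed
    show "(\<lambda>(t, w). w(d := t)) ` ?S \<subseteq> lattice_ball (Suc d) r"
    proof clarify
      fix t w assume t: "t \<in> {- int r..int r}" and w: "w \<in> lattice_ball d (r - nat \<bar>t\<bar>)"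
      have "(\<Sum>i<d. \<bar>(w(d := t)) i\<bar>) = (\<Sum>i<d. \<bar>w i\<bar>)" by (intro sum.cong) auto
      moreover have "int (r - nat \<bar>t\<bar>) = int r - \<bar>t\<bar>" using t by (subst of_nat_diff) auto
      ultimately show "w(d := t) \<in> lattice_ball (Suc d) r"
        using w by (simp add: lattice_ball_def PiE_iff extensional_def)
    qed
  qed
  then have "card (lattice_ball (Suc d) r) = card ?S" by (rule bij_betw_same_card)
  also have "\<dots> = (\<Sum>t\<in>{- int r..int r}. card (lattice_ball d (r - nat \<bar>t\<bar>)))"
    by (rule card_SigmaI) (auto simp: finite_lattice_ball)
  also have "\<dots> = card (lattice_ball d r) + 2 * (\<Sum>i<r. card (lattice_ball d (r - Suc i)))"
    by (subst sum_symmetric_interval[where h = "\<lambda>t. card (lattice_ball d (r - t))"]) simp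
  also have "(\<Sum>i<r. card (lattice_ball d (r - Suc i))) = (\<Sum>s<r. card (lattice_ball d s))"
    by (rule sum.nat_diff_reindex)
  finally show ?thesis .
qed

lemma card_lattice_ball_0: "card (lattice_ball 0 r) = 1"
proof -
  have "lattice_ball 0 r = {\<lambda>_. undefined}" by (auto simp: lattice_ball_def)
  then show ?thesis by simp
qed

lemma sum_choose_lessThan: "(\<Sum>s<r. s choose d) = r choose Suc d"
  by (induction r) auto

lemma sum_choose_add_lessThan: "(\<Sum>s<r. (s + d) choose d) = (r + d) choose Suc d"
  by (induction r) auto

lemma card_lattice_ball_le: "card (lattice_ball d r) \<le> 2 ^ d * ((r + d) choose d)"
proof (induction d arbitrary: r)
  case 0
  show ?case by (simp add: card_lattice_ball_0)
next
  case (Suc d)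
  have "card (lattice_ball (Suc d) r) \<le> 2 * (\<Sum>s<Suc r. card (lattice_ball d s))"
    by (simp add: card_lattice_ball_Suc)
  also have "\<dots> \<le> 2 * (\<Sum>s<Suc r. 2 ^ d * ((s + d) choose d))"
    by (intro mult_left_mono sum_mono Suc.IH) auto
  also have "\<dots> = 2 ^ Suc d * (\<Sum>s<Suc r. (s + d) choose d)"
    by (simp only: sum_distrib_left power_Suc mult.assoc)
  also have "\<dots> = 2 ^ Suc d * ((r + Suc d) choose Suc d)"
    by (simp only: sum_choose_add_lessThan add_Suc_shift)
  finally show ?case .
qed

lemma card_lattice_ball_ge: "2 ^ d * (r choose d) \<le> card (lattice_ball d r)"
proof (induction d arbitrary: r)
  case 0
  show ?case by (simp add: card_lattice_ball_0)
next
  case (Suc d)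
  have "2 ^ Suc d * (r choose Suc d) = 2 * (\<Sum>s<r. 2 ^ d * (s choose d))"
    by (simp only: sum_choose_lessThan[symmetric] sum_distrib_left power_Suc mult.assoc)
  also have "\<dots> \<le> 2 * (\<Sum>s<r. card (lattice_ball d s))"
    by (intro mult_left_mono sum_mono Suc.IH) auto
  also have "\<dots> \<le> card (lattice_ball (Suc d) r)" by (simp add: card_lattice_ball_Suc)
  finally show ?case .
qed

section \<open>Balls in the torus\<close>

text \<open>Translation of the torus vertex \<open>x\<close> by the integer vector \<open>w\<close>, reduced modulo \<open>n\<close>.\<close>

definition torus_shift :: "nat \<Rightarrow> nat \<Rightarrow> (nat \<Rightarrow> int) \<Rightarrow> (nat \<Rightarrow> int) \<Rightarrow> nat \<Rightarrow> int" where
  "torus_shift d n x w = (\<lambda>i\<in>{..<d}. (x i + w i) mod int n)"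

lemma pverts_torus: "pverts (torus d n) = {..<d} \<rightarrow>\<^sub>E {0..<int n}"
  by (simp add: torus_def)

lemma card_pverts_torus: "card (pverts (torus d n)) = n ^ d"
  by (simp add: pverts_torus card_PiE)

lemma torus_shift_in: "n \<ge> 1 \<Longrightarrow> torus_shift d n x w \<in> pverts (torus d n)"
  by (auto simp: torus_shift_def pverts_torus)

lemma torus_arc_shift:
  assumes "(x, y) \<in> parcs (torus d n)"
  obtains i s where "i < d" "\<bar>s\<bar> = 1" "y = torus_shift d n x ((\<lambda>j\<in>{..<d}. 0)(i := s))"
proof -
  from assms have V: "x \<in> {..<d} \<rightarrow>\<^sub>E {0..<int n}" "y \<in> {..<d} \<rightarrow>\<^sub>E {0..<int n}"
    by (auto simp: torus_def)
  from assms obtain i where i: "i < d" "[y i = x i + 1] (mod int n) \<or> [y i = x i - 1] (mod int n)"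
    "\<forall>j<d. j \<noteq> i \<longrightarrow> y j = x j" by (auto simp: torus_def)
  from i(2) obtain s where s: "\<bar>s\<bar> = 1" "[y i = x i + s] (mod int n)"
    by (metis abs_minus_cancel abs_one diff_conv_add_uminus)
  have m: "y j mod int n = y j" if "j < d" for j using V that by (auto simp: PiE_iff)
  have yi: "y i = (x i + s) mod int n" using s(2) m[OF i(1)] unfolding Cong.cong_def by metis
  have "y j = torus_shift d n x ((\<lambda>j\<in>{..<d}. 0)(i := s)) j" for j
    using i(1,3) yi V
    by (cases "j < d"; cases "j = i") (auto simp: torus_shift_def PiE_iff extensional_def)
  then show ?thesis using that i(1) s(1) by blast
qed

text \<open>
  The identity occurs only for \<open>n = 1\<close>, when a unit step does not leave the vertex.
\<close>

lemma torus_shift_arc: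
  assumes "n \<ge> 1" "x \<in> pverts (torus d n)" "i < d" "\<bar>s\<bar> = 1"
  shows "(torus_shift d n x w, torus_shift d n x (w(i := w i + s))) \<in> parcs (torus d n) \<union> Id"
proof -
  let ?y = "torus_shift d n x w" and ?z = "torus_shift d n x (w(i := w i + s))"
  have V: "?y \<in> {..<d} \<rightarrow>\<^sub>E {0..<int n}" "?z \<in> {..<d} \<rightarrow>\<^sub>E {0..<int n}"
    using torus_shift_in[OF assms(1)] by (auto simp: pverts_torus)
  have "?z i = (x i + w i + s) mod int n" "?y i = (x i + w i) mod int n"
    using assms(3) by (simp_all add: torus_shift_def add.assoc)
  then have "[?z i = ?y i + s] (mod int n)" by (simp only: Cong.cong_def mod_simps mod_mod_trivial)
  moreover have "s = 1 \<or> s = - 1" using assms(4) by auto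
  ultimately have "[?z i = ?y i + 1] (mod int n) \<or> [?z i = ?y i - 1] (mod int n)" by auto
  moreover have "\<forall>j<d. j \<noteq> i \<longrightarrow> ?z j = ?y j" by (auto simp: torus_shift_def)
  ultimately show ?thesis using V assms(3) by (auto simp: torus_def)
qed

lemma torus_relpow_imp_shift:
  assumes "n \<ge> 1" "x \<in> pverts (torus d n)" "(x, y) \<in> (parcs (torus d n) \<union> Id) ^^ r"
  shows "y \<in> torus_shift d n x ` lattice_ball d r"
  using assms(3)
proof (induction r arbitrary: y)
  case 0
  then have "y = x" by simp
  also have "x = torus_shift d n x (\<lambda>i\<in>{..<d}. 0)"
    using assms(2) by (auto simp: torus_shift_def pverts_torus fun_eq_iff PiE_iff extensional_def)
  finally have "y = torus_shift d n x (\<lambda>i\<in>{..<d}. 0)" .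
  moreover have "(\<lambda>i\<in>{..<d}. 0) \<in> lattice_ball d 0" by (simp add: lattice_ball_def)
  ultimately show ?case by blast
next
  case (Suc r)
  then obtain z where z: "(x, z) \<in> (parcs (torus d n) \<union> Id) ^^ r"
    and zy: "(z, y) \<in> parcs (torus d n) \<union> Id" by auto
  from Suc.IH[OF z] obtain w where w: "w \<in> lattice_ball d r" "z = torus_shift d n x w" by blast
  show ?case
  proof (cases "y = z")
    case True
    then show ?thesis using w by (auto simp: lattice_ball_def)
  next
    case False
    then have "(z, y) \<in> parcs (torus d n)" using zy by auto
    then obtain i s where i: "i < d" "\<bar>s\<bar> = 1"
      "y = torus_shift d n z ((\<lambda>j\<in>{..<d}. 0)(i := s))" by (rule torus_arc_shift)
    have "y = torus_shift d n x (w(i := w i + s))"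
      unfolding i(3) w(2) by (auto simp: torus_shift_def fun_eq_iff mod_simps algebra_simps)
    moreover have "w(i := w i + s) \<in> lattice_ball d (Suc r)"
    proof -
      have "(\<Sum>j<d. \<bar>(w(i := w i + s)) j\<bar>) \<le> (\<Sum>j<d. \<bar>w j\<bar> + (if j = i then 1 else 0))"
        using i(2) by (intro sum_mono) auto
      also have "\<dots> = (\<Sum>j<d. \<bar>w j\<bar>) + 1" using i(1) by (simp add: sum.distrib)
      finally show ?thesis using w(1) i(1) by (auto simp: lattice_ball_def PiE_iff extensional_def)
    qed
    ultimately show ?thesis by blast
  qed
qed

lemma torus_shift_imp_relpow:
  assumes "n \<ge> 1" "x \<in> pverts (torus d n)" "w \<in> lattice_ball d r"
  shows "(x, torus_shift d n x w) \<in> (parcs (torus d n) \<union> Id) ^^ r"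
  using assms(3)
proof (induction r arbitrary: w)
  case 0
  then have "\<forall>i<d. w i = 0" using abs_le_of_lattice_ball[OF 0] by auto
  then have "torus_shift d n x w = x"
    using assms(2) by (auto simp: torus_shift_def pverts_torus fun_eq_iff PiE_iff extensional_def)
  then show ?case by simp
next
  case (Suc r)
  show ?case
  proof (cases "\<forall>i<d. w i = 0")
    case True
    then have "w \<in> lattice_ball d r" using Suc.prems by (auto simp: lattice_ball_def)
    from Suc.IH[OF this] show ?thesis by (auto intro: relpow_Suc_I)
  next
    case False
    then obtain i where i: "i < d" "w i \<noteq> 0" by blast
    \<comment> \<open>Move a nonzero coordinate one step towards 0.\<close>
    define w' where "w' = w(i := w i - sgn (w i))"
    have "(\<Sum>j<d. \<bar>w' j\<bar>) = (\<Sum>j<d. \<bar>w j\<bar> - (if j = i then 1 else 0))"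
      using i(2) by (intro sum.cong) (auto simp: w'_def sgn_if)
    also have "\<dots> = (\<Sum>j<d. \<bar>w j\<bar>) - 1" using i(1) by (simp add: sum_subtractf)
    finally have "w' \<in> lattice_ball d r"
      using Suc.prems i(1) by (auto simp: lattice_ball_def w'_def PiE_iff extensional_def)
    from Suc.IH[OF this] have 1: "(x, torus_shift d n x w') \<in> (parcs (torus d n) \<union> Id) ^^ r" .
    have "\<bar>sgn (w i)\<bar> = 1" using i(2) by (auto simp: sgn_if)
    from torus_shift_arc[OF assms(1,2) i(1) this, of w']
    have "(torus_shift d n x w', torus_shift d n x w) \<in> parcs (torus d n) \<union> Id"
      by (simp add: w'_def)
    with 1 show ?thesis by (rule relpow_Suc_I)
  qed
qed

lemma graph_cball_torus:
  assumes "n \<ge> 1" "x \<in> pverts (torus d n)"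
  shows "graph_cball (with_proj (torus d n)) x r = torus_shift d n x ` lattice_ball d r"
proof -
  interpret pair_graph "torus d n" by (rule pair_graph_torus)
  show ?thesis
    using mem_graph_cball_iff[of x _ r] assms torus_relpow_imp_shift[OF assms]
      torus_shift_imp_relpow[OF assms]
    by auto
qed

lemma inj_on_torus_shift:
  assumes "2 * r < n"
  shows "inj_on (torus_shift d n x) (lattice_ball d r)"
proof (rule inj_onI)
  fix v w assume v: "v \<in> lattice_ball d r" and w: "w \<in> lattice_ball d r"
    and eq: "torus_shift d n x v = torus_shift d n x w"
  have "v i = w i" for i
  proof (cases "i < d")
    case True
    then have "(x i + v i) mod int n = (x i + w i) mod int n"
      using fun_cong[OF eq, of i] by (simp add: torus_shift_def)
    then have "int n dvd (x i + v i) - (x i + w i)" by (rule mod_eqE) auto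
    then have "int n dvd v i - w i" by simp
    moreover have "\<bar>v i - w i\<bar> < int n"
      using abs_le_of_lattice_ball[OF v True] abs_le_of_lattice_ball[OF w True] assms by linarith
    ultimately show ?thesis using dvd_imp_le_int[of "v i - w i" "int n"] by fastforce
  next
    case False
    then show ?thesis using v w by (auto simp: lattice_ball_def PiE_iff extensional_def)
  qed
  then show "v = w" by blast
qed

section \<open>Bounds on the burning number of the torus\<close>

lemma burning_number_torus_lower:
  assumes "n \<ge> 1"
  shows "fact (d + 1) * n ^ d \<le> 2 ^ d * (burning_number (with_proj (torus d n)) + d) ^ (d + 1)"
proof -
  interpret pair_graph "torus d n" by (rule pair_graph_torus)
  let ?G = "with_proj (torus d n)"
  define b where "b = burning_number ?G"
  have ne: "verts ?G \<noteq> {}" using torus_shift_in[OF assms] by fastforce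
  obtain x where x: "\<And>i. i \<in> {1..b} \<Longrightarrow> x i \<in> verts ?G"
    "(\<Union>i\<in>{1..b}. graph_cball ?G (x i) (b - i)) = verts ?G"
    unfolding b_def by (rule burning_number_attained) (use ne in auto)
  have "n ^ d = card (\<Union>i\<in>{1..b}. graph_cball ?G (x i) (b - i))"
    using x(2) card_pverts_torus by simp
  also have "\<dots> \<le> (\<Sum>i\<in>{1..b}. card (graph_cball ?G (x i) (b - i)))"
    by (rule card_UN_le) simp
  also have "\<dots> \<le> (\<Sum>i\<in>{1..b}. 2 ^ d * ((b - i + d) choose d))"
  proof (rule sum_mono)
    fix i assume "i \<in> {1..b}"
    then have "card (graph_cball ?G (x i) (b - i)) \<le> card (lattice_ball d (b - i))"
      using graph_cball_torus[OF assms] x(1) card_image_le[OF finite_lattice_ball] by simp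
    also have "\<dots> \<le> 2 ^ d * ((b - i + d) choose d)" by (rule card_lattice_ball_le)
    finally show "card (graph_cball ?G (x i) (b - i)) \<le> 2 ^ d * ((b - i + d) choose d)" .
  qed
  also have "\<dots> = (\<Sum>s<b. 2 ^ d * ((s + d) choose d))"
    by (rule sum.reindex_bij_witness[of _ "\<lambda>i. b - i" "\<lambda>r. b - r"]) auto
  also have "\<dots> = 2 ^ d * ((b + d) choose Suc d)"
    by (simp only: sum_distrib_left[symmetric] sum_choose_add_lessThan)
  finally have "fact (d + 1) * n ^ d \<le> fact (d + 1) * (2 ^ d * ((b + d) choose Suc d))"
    by (rule mult_left_mono) simp
  also have "\<dots> = 2 ^ d * (((b + d) choose (d + 1)) * fact (d + 1))" by simp
  also have "\<dots> \<le> 2 ^ d * (b + d) ^ (d + 1)"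
    by (intro mult_left_mono binomial_fact_pow) simp
  finally show ?thesis unfolding b_def .
qed

lemma choose_fact_ge_power: "(m - d) ^ d \<le> (m choose d) * fact d"
proof (induction d arbitrary: m)
  case (Suc d)
  show ?case
  proof (cases m)
    case (Suc m')
    have "(m - Suc d) ^ Suc d = (m' - d) * (m' - d) ^ d" by (simp add: Suc)
    also have "\<dots> \<le> m * ((m' choose d) * fact d)"
      by (intro mult_mono Suc.IH) (auto simp: Suc)
    also have "\<dots> = (Suc d * (m choose Suc d)) * fact d"
      using Suc_times_binomial_eq[of m' d] by (simp add: Suc algebra_simps)
    finally show ?thesis by (simp add: algebra_simps)
  qed simp
qed simp

lemma sum_half: "(\<Sum>r<2 * m. f (r div 2)) = 2 * (\<Sum>s<m. f s)" for f :: "nat \<Rightarrow> nat"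
  by (induction m) auto

text \<open>
  The side condition \<open>2 * m \<le> n\<close> makes the halved radii, which are less than \<open>m\<close>, small enough
  for the balls not to wrap around the torus.
\<close>

lemma burning_number_torus_upper:
  assumes "n \<ge> 1" "2 * m \<le> n"
    and vol: "fact (d + 1) * n ^ d < (2 * (m - (d + 1))) ^ (d + 1)"
  shows "burning_number (with_proj (torus d n)) \<le> 2 * m"
proof -
  interpret pair_graph "torus d n" by (rule pair_graph_torus)
  let ?G = "with_proj (torus d n)"
  show ?thesis
  proof (rule burning_number_le[where g = "\<lambda>r. 2 ^ d * ((r div 2) choose d)"])
    show "pverts (torus d n) \<noteq> {}" using torus_shift_in[OF assms(1)] by fastforce
  next
    fix x r assume x: "x \<in> pverts (torus d n)" and r: "r < 2 * m"
    have "2 ^ d * ((r div 2) choose d) \<le> card (lattice_ball d (r div 2))"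
      by (rule card_lattice_ball_ge)
    also have "\<dots> = card (graph_cball ?G x (r div 2))"
      using x r assms by (simp add: graph_cball_torus card_image inj_on_torus_shift)
    finally show "2 ^ d * ((r div 2) choose d) \<le> card (graph_cball ?G x (r div 2))" .
  next
    have "fact (d + 1) * n ^ d < 2 ^ (d + 1) * (m - (d + 1)) ^ (d + 1)"
      using vol by (simp only: power_mult_distrib)
    also have "\<dots> \<le> 2 ^ (d + 1) * ((m choose (d + 1)) * fact (d + 1))"
      by (intro mult_left_mono choose_fact_ge_power) simp
    finally have "fact (d + 1) * n ^ d < fact (d + 1) * (2 ^ (d + 1) * (m choose (d + 1)))"
      by (simp only: mult_ac)
    then have "n ^ d < 2 ^ (d + 1) * (m choose (d + 1))"
      by (simp only: mult_less_cancel1)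
    also have "\<dots> = (\<Sum>r<2 * m. 2 ^ d * ((r div 2) choose d))"
      unfolding sum_half[where f = "\<lambda>s. 2 ^ d * (s choose d)"]
        sum_distrib_left[of "2 ^ d" _ "{..<m}", symmetric] sum_choose_lessThan by simp
    finally show "card (pverts (torus d n)) < (\<Sum>r<2 * m. 2 ^ d * ((r div 2) choose d))"
      by (simp add: card_pverts_torus)
  qed
qed

section \<open>Asymptotics\<close>

lemma powr_inverse_power:
  assumes "c \<ge> 0"
  shows "(c powr (1 / real (d + 1))) ^ (d + 1) = c"
proof -
  have "(c powr (1 / real (d + 1))) ^ (d + 1) = (c powr (1 / real (d + 1))) powr real (d + 1)"
    by (rule powr_realpow'[symmetric]) auto
  also have "\<dots> = c powr 1" by (simp only: powr_powr) simp
  finally show ?thesis using assms by simp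
qed

lemma powr_ratio_power:
  assumes "n \<ge> 1"
  shows "(real n powr (real d / real (d + 1))) ^ (d + 1) = real n ^ d"
proof -
  have "(real n powr (real d / real (d + 1))) ^ (d + 1) =
      (real n powr (real d / real (d + 1))) powr real (d + 1)"
    using assms by (intro powr_realpow[symmetric]) auto
  also have "\<dots> = real n powr real d" by (simp only: powr_powr) simp
  also have "\<dots> = real n ^ d" using assms by (intro powr_realpow) auto
  finally show ?thesis .
qed

lemma burning_alpha_torus:
  assumes "n \<ge> 1"
  shows "burning_alpha d * real n powr (real d / real (d + 1)) - real d
    \<le> real (burning_number (with_proj (torus d n)))"
proof -
  let ?b = "burning_number (with_proj (torus d n))"
  have "(burning_alpha d * real n powr (real d / real (d + 1))) ^ (d + 1)
      = fact (d + 1) / 2 ^ d * real n ^ d"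
    unfolding power_mult_distrib powr_ratio_power[OF assms] burning_alpha_def
    by (subst powr_inverse_power) auto
  also have "\<dots> \<le> real (?b + d) ^ (d + 1)"
  proof -
    have "real (fact (d + 1) * n ^ d) \<le> real (2 ^ d * (?b + d) ^ (d + 1))"
      using burning_number_torus_lower[OF assms] by (rule of_nat_mono)
    then show ?thesis by (simp add: field_simps del: fact_Suc power_Suc)
  qed
  finally have "burning_alpha d * real n powr (real d / real (d + 1)) \<le> real (?b + d)"
    by (rule power_le_imp_le_base[where n = d, unfolded Suc_eq_plus1]) simp
  then show ?thesis by simp
qed

text \<open>
  The condition \<open>2 * m \<le> n\<close> for the greedy bound holds for large \<open>n\<close> because
  \<open>n = n powr (1 / (d + 1)) * n powr (d / (d + 1))\<close> and the first factor is unbounded.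
\<close>

lemma burning_number_torus_eventually_le:
  defines "\<beta> \<equiv> \<lambda>d. fact (d + 1) powr (1 / real (d + 1))"
  assumes "d \<ge> 1"
  shows "\<forall>\<^sub>F n in sequentially. real (burning_number (with_proj (torus d n)))
    \<le> \<beta> d * real n powr (real d / real (d + 1)) + real (2 * d + 4)"
proof -
  let ?N = "\<lambda>n. real n powr (real d / real (d + 1))"
  have "filterlim (\<lambda>n. real n powr (1 / real (d + 1))) at_top sequentially"
    by real_asymp
  then have ev: "\<forall>\<^sub>F n in sequentially. \<beta> d + real (2 * d + 4) \<le> real n powr (1 / real (d + 1))"
    by (simp add: filterlim_at_top)
  show ?thesis
    using ev eventually_ge_at_top[of 1]
  proof eventually_elim
    case (elim n)
    \<comment> \<open>The summand \<open>d + 2\<close> makes \<open>2 * (m - (d + 1))\<close> strictly larger than \<open>\<beta> d * ?N n\<close>, as the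
      volume condition of the greedy bound demands.\<close>
    define m where "m = nat \<lfloor>\<beta> d * ?N n / 2\<rfloor> + d + 2"
    have \<beta>: "\<beta> d \<ge> 0" by (simp add: \<beta>_def)
    have m: "\<beta> d * ?N n < 2 * real (m - (d + 1))" "2 * real m \<le> \<beta> d * ?N n + real (2 * d + 4)"
      unfolding m_def using \<beta> by (auto simp: of_nat_diff) linarith+
    have "1 \<le> ?N n" using elim by (intro ge_one_powr_ge_zero) auto
    then have "2 * real m \<le> (\<beta> d + real (2 * d + 4)) * ?N n"
      using m(2) mult_left_mono[of 1 "?N n" "real (2 * d + 4)"] by (simp add: distrib_right)
    also have "\<dots> \<le> real n powr (1 / real (d + 1)) * ?N n"
      by (intro mult_right_mono elim) auto
    also have "\<dots> = real n powr (1 / real (d + 1) + real d / real (d + 1))"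
      by (simp only: powr_add)
    also have "1 / real (d + 1) + real d / real (d + 1) = 1" by (simp add: field_simps)
    finally have "2 * m \<le> n" using elim by simp
    have "real (fact (d + 1) * n ^ d) = fact (d + 1) * real n ^ d"
      by (simp only: of_nat_mult of_nat_fact of_nat_power)
    also have "\<dots> = (\<beta> d * ?N n) ^ (d + 1)"
      unfolding power_mult_distrib powr_ratio_power[OF elim(2)] \<beta>_def
      by (subst powr_inverse_power) (rule fact_ge_zero, rule refl)
    also have "\<dots> < (2 * real (m - (d + 1))) ^ (d + 1)"
      using m(1) \<beta> by (intro power_strict_mono) auto
    also have "\<dots> = real ((2 * (m - (d + 1))) ^ (d + 1))" by simp
    finally have "fact (d + 1) * n ^ d < (2 * (m - (d + 1))) ^ (d + 1)"
      by (simp only: of_nat_less_iff)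
    from burning_number_torus_upper[OF elim(2) \<open>2 * m \<le> n\<close> this]
    have "real (burning_number (with_proj (torus d n))) \<le> 2 * real m" by linarith
    with m(2) show ?case by linarith
  qed
qed

lemma fact_root_le_burning_gamma:
  assumes "d \<ge> 1"
  shows "fact (d + 1) powr (1 / real (d + 1)) \<le> burning_gamma d"
  unfolding burning_gamma_def
proof (rule powr_mono2)
  have "(1 :: real) \<le> (1 + 1 / real d) ^ d" by (intro one_le_power) simp
  then show "fact (d + 1) \<le> (1 + 1 / real d) ^ d * fact (d + 1)"
    using mult_right_mono[of 1 "(1 + 1 / real d) ^ d" "fact (d + 1)"] by simp
qed auto

theorem proposition1:
  fixes d :: nat
  assumes "d \<ge> 1"
  shows "\<exists>e1 e2 :: nat \<Rightarrow> real. e1 \<in> o(\<lambda>_. 1) \<and> e2 \<in> o(\<lambda>_. 1) \<and>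
    (\<forall>n\<ge>1.
       (burning_alpha d + e1 n) * real n powr (real d / real (d + 1))
         \<le> real (burning_number (with_proj (torus d n))) \<and>
       real (burning_number (with_proj (torus d n)))
         \<le> (burning_gamma d + e2 n) * real n powr (real d / real (d + 1)))"
proof -
  let ?N = "\<lambda>n. real n powr (real d / real (d + 1))"
  let ?b = "\<lambda>n. real (burning_number (with_proj (torus d n)))"
  have lim: "(\<lambda>n. c / ?N n) \<longlonglongrightarrow> 0" for c
  proof -
    have "0 < real d / real (d + 1)" using assms by simp
    then show ?thesis by real_asymp
  qed
  define e1 where "e1 = (\<lambda>n. - real d / ?N n)"
  \<comment> \<open>The greedy bound is available only for large \<open>n\<close>; defining \<open>e2\<close> as the actual excess makes the
    upper bound hold for every \<open>n \<ge> 1\<close>.\<close>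
  define e2 where "e2 = (\<lambda>n. max 0 (?b n / ?N n - burning_gamma d))"
  have "e1 \<in> o(\<lambda>_. 1)" unfolding e1_def by (intro smalloI_tendsto) (use lim[of "- real d"] in auto)
  moreover have "e2 \<in> o(\<lambda>_. 1)"
  proof (rule smalloI_tendsto)
    have "e2 \<longlonglongrightarrow> 0"
    proof (rule tendsto_sandwich[OF _ _ tendsto_const lim])
      show "\<forall>\<^sub>F n in sequentially. 0 \<le> e2 n" by (simp add: e2_def)
      show "\<forall>\<^sub>F n in sequentially. e2 n \<le> real (2 * d + 4) / ?N n"
        using burning_number_torus_eventually_le[OF assms] eventually_ge_at_top[of 1]
      proof eventually_elim
        case (elim n)
        then have N: "?N n > 0" by simp
        have "?b n \<le> burning_gamma d * ?N n + real (2 * d + 4)"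
          using elim(1) mult_right_mono[OF fact_root_le_burning_gamma[OF assms], of "?N n"] N
          by linarith
        then have "?b n / ?N n - burning_gamma d \<le> real (2 * d + 4) / ?N n"
          using N by (simp only: diff_le_eq pos_divide_le_eq distrib_right) simp
        moreover have "0 \<le> real (2 * d + 4) / ?N n" using N by simp
        ultimately show ?case by (simp only: e2_def max.bounded_iff simp_thms)
      qed
    qed
    then show "(\<lambda>n. e2 n / 1) \<longlonglongrightarrow> 0" by simp
  qed auto
  moreover have "(burning_alpha d + e1 n) * ?N n \<le> ?b n \<and> ?b n \<le> (burning_gamma d + e2 n) * ?N n"
    if n: "n \<ge> 1" for n
  proof
    have N: "?N n > 0" using n by simp
    have "(burning_alpha d + e1 n) * ?N n = burning_alpha d * ?N n - real d"
      using N by (simp add: e1_def field_simps)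
    then show "(burning_alpha d + e1 n) * ?N n \<le> ?b n" using burning_alpha_torus[OF n, of d] by simp
    have "?b n / ?N n \<le> burning_gamma d + e2 n" by (simp add: e2_def)
    then show "?b n \<le> (burning_gamma d + e2 n) * ?N n" using N by (simp only: pos_divide_le_eq)
  qed
  ultimately show ?thesis by blast
qed

end
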